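(* Let $g_0(\rho)$, $\delta(\tau,\rho)$ and $\vartheta(t,\rho)$ be as defined in the context. Assume that $$|\delta(\tau,\rho)| < \frac{1}{35}\,\tau \qquad \text{for all } \tau>0 \text{ and all } \rho>0 .$$ Then $$|\vartheta(t,\rho)| \le \frac{1}{70}\, t \qquad \text{for all } t>0 \text{ and all } \rho>0 .$$
   Context: For $\rho>0$ let $$h(\xi)=\tfrac12\xi^2+\rho\cosh\xi-i\pi\xi,\qquad g(\xi,\rho)=\frac{\sinh\xi}{\xi+\rho\sinh\xi-i\pi}\qquad(\xi\in\mathbb C).$$ Saddle point $X=X(\rho)$ of $h$: - if $0<\rho<1$, $X=x_1+i\pi$, where $x_1>0$ is the solution of $\rho\,\frac{\sinh x_1}{x_1}=1$; - if $\rho=1$, $X=i\pi$; - if $\rho>1$, $X=iy_1$, where $y_1\in(0,\pi)$ is the solution of $y_1+\rho\sin y_1=\pi$. Steepest descent path: $\xi(\tau)$, $\tau\ge 0$, is the continuous curve with $\xi(0)=X$, $h(\xi(\tau))-h(X)=\tau$ (so $\tau$ is a real parameter along the path), which for $\tau>0$ lies in the half-strip $\{\operatorname{Re}\xi>0,\ 0<\operatorname{Im}\xi<\pi\}$ and satisfies $\operatorname{Re}\xi(\tau)\to+\infty$ as $\tau\to\infty$. For $\tau>0$ write $g(\tau,\rho):=g(\xi(\tau),\rho)$. The coefficient $g_0(\rho)$ of $\tau^{-1/2}$ in the expansion of $\operatorname{Im} g(\tau,\rho)$ as $\tau\to0^+$ is $$g_0(\rho)=\begin{cases}\dfrac{\sinh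 x_1}{\sqrt{2(\rho\cosh x_1-1)}}, & 0<\rho<1,\\[2mm] \sqrt{3/2}, & \rho=1,\\[1mm] \dfrac{\sin y_1}{\sqrt{2(\rho\cos y_1+1)}}, & \rho>1.\end{cases}$$ The function $\delta(\tau,\rho)$ is defined for $\tau>0$ by $$\operatorname{Im} g(\tau,\rho)=g_0(\rho)\,\frac{1}{\sqrt\tau}\,\bigl(1+\delta(\tau,\rho)\bigr),$$ and $\vartheta(t,\rho)$ is defined for $t>0$ by $$\operatorname{Im}\int_0^\infty e^{-\tau/t}\,g(\tau,\rho)\,d\tau=\sqrt{\pi t}\;g_0(\rho)\,\bigl(1+\vartheta(t,\rho)\bigr).$$ *)

theory Defs
  imports "HOL-Analysis.Analysis" "HOL-Real_Asymp.Real_Asymp"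
begin

definition h :: "real \<Rightarrow> complex \<Rightarrow> complex" where
  "h \<rho> \<xi> = \<xi>\<^sup>2 / 2 + of_real \<rho> * cosh \<xi> - \<i> * of_real pi * \<xi>"

text \<open>The denominator of \<open>g\<close> is the derivative of \<open>h \<rho>\<close>; it vanishes at the saddle point, where
  \<open>g\<close> takes the value \<open>0\<close> by the convention for division by zero.\<close>

definition g :: "complex \<Rightarrow> real \<Rightarrow> complex" where
  "g \<xi> \<rho> = sinh \<xi> / (\<xi> + of_real \<rho> * sinh \<xi> - \<i> * of_real pi)"

lemma has_field_derivative_h:
  "(h \<rho> has_field_derivative (\<xi> + of_real \<rho> * sinh \<xi> - \<i> * of_real pi)) (at \<xi>)"
  unfolding h_def [abs_def] by (auto intro!: derivative_eq_intros)


definition x1 :: "real \<Rightarrow> real" where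
  "x1 \<rho> = (THE x. x > 0 \<and> \<rho> * (sinh x / x) = 1)"

definition y1 :: "real \<Rightarrow> real" where
  "y1 \<rho> = (THE y. y \<in> {0<..<pi} \<and> y + \<rho> * sin y = pi)"

definition saddle_point :: "real \<Rightarrow> complex" where
  "saddle_point \<rho> =
     (if \<rho> < 1 then of_real (x1 \<rho>) + \<i> * of_real pi
      else if \<rho> = 1 then \<i> * of_real pi
      else \<i> * of_real (y1 \<rho>))"

definition steepest_descent_path :: "real \<Rightarrow> (real \<Rightarrow> complex) \<Rightarrow> bool" where
  "steepest_descent_path \<rho> \<xi> \<longleftrightarrow>
     continuous_on {0..} \<xi> \<and>
     \<xi> 0 = saddle_point \<rho> \<and>
     (\<forall>\<tau>\<ge>0. h \<rho> (\<xi> \<tau>) - h \<rho> (saddle_point \<rho>) = of_real \<tau>) \<and>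
     (\<forall>\<tau>>0. 0 < Re (\<xi> \<tau>) \<and> 0 < Im (\<xi> \<tau>) \<and> Im (\<xi> \<tau>) < pi) \<and>
     filterlim (\<lambda>\<tau>. Re (\<xi> \<tau>)) at_top at_top"

definition g0 :: "real \<Rightarrow> real" where
  "g0 \<rho> =
     (if \<rho> < 1 then sinh (x1 \<rho>) / sqrt (2 * (\<rho> * cosh (x1 \<rho>) - 1))
      else if \<rho> = 1 then sqrt (3 / 2)
      else sin (y1 \<rho>) / sqrt (2 * (\<rho> * cos (y1 \<rho>) + 1)))"

text \<open>The functions \<open>\<delta>\<close> and \<open>\<vartheta>\<close> are obtained by solving their defining equations, stated below as
  \<open>delta_eq\<close> and \<open>theta_eq\<close>; this is legitimate since \<open>g0 \<rho> > 0\<close>. The path \<open>\<xi>\<close>, on which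
  both depend, is an explicit argument.\<close>

definition delta :: "(real \<Rightarrow> complex) \<Rightarrow> real \<Rightarrow> real \<Rightarrow> real" where
  "delta \<xi> \<tau> \<rho> = Im (g (\<xi> \<tau>) \<rho>) / (g0 \<rho> * (1 / sqrt \<tau>)) - 1"

definition theta :: "(real \<Rightarrow> complex) \<Rightarrow> real \<Rightarrow> real \<Rightarrow> real" where
  "theta \<xi> t \<rho> =
     Im (LBINT \<tau>:{0<..}. of_real (exp (- \<tau> / t)) * g (\<xi> \<tau>) \<rho>) / (sqrt (pi * t) * g0 \<rho>) - 1"


subsection \<open>Well-definedness\<close>

lemma sinh_less_mult_cosh:
  fixes x :: real assumes "x > 0" shows "sinh x < x * cosh x"
proof -
  have "(\<lambda>x. x * cosh x - sinh x) 0 < (\<lambda>x::real. x * cosh x - sinh x) x"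
  proof (rule DERIV_pos_imp_increasing_open [OF assms])
    fix u :: real assume "0 < u" "u < x"
    have "((\<lambda>x. x * cosh x - sinh x) has_real_derivative u * sinh u) (at u)"
      by (auto intro!: derivative_eq_intros)
    with \<open>0 < u\<close> show "\<exists>y. ((\<lambda>x. x * cosh x - sinh x) has_real_derivative y) (at u) \<and> 0 < y"
      by (intro exI [of _ "u * sinh u"]) auto
  qed (auto intro!: continuous_intros)
  then show ?thesis by simp
qed

lemma mult_cos_less_sin:
  fixes z :: real assumes "0 < z" "z < pi" shows "z * cos z < sin z"
proof -
  have "(\<lambda>z. sin z - z * cos z) 0 < (\<lambda>z::real. sin z - z * cos z) z"
  proof (rule DERIV_pos_imp_increasing_open [OF assms(1)])
    fix u :: real assume u: "0 < u" "u < z"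
    have "((\<lambda>z. sin z - z * cos z) has_real_derivative u * sin u) (at u)"
      by (auto intro!: derivative_eq_intros)
    moreover have "sin u > 0" using u assms by (intro sin_gt_zero) auto
    ultimately show "\<exists>y. ((\<lambda>z. sin z - z * cos z) has_real_derivative y) (at u) \<and> 0 < y"
      using u by (intro exI [of _ "u * sin u"]) auto
  qed (auto intro!: continuous_intros)
  then show ?thesis by simp
qed

lemma sinh_div_strict_mono:
  fixes a b :: real assumes "0 < a" "a < b" shows "sinh a / a < sinh b / b"
proof (rule DERIV_pos_imp_increasing [OF assms(2)])
  fix x assume "a \<le> x" "x \<le> b"
  with assms have x: "x > 0" by simp
  have "((\<lambda>x. sinh x / x) has_real_derivative (cosh x * x - sinh x) / (x * x)) (at x)"
    using x by (auto intro!: derivative_eq_intros)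
  with x sinh_less_mult_cosh [OF x]
  show "\<exists>y. ((\<lambda>x. sinh x / x) has_real_derivative y) (at x) \<and> 0 < y"
    by (intro exI [of _ "(cosh x * x - sinh x) / (x * x)"]) (auto simp: mult.commute)
qed

lemma sin_div_strict_antimono:
  fixes a b :: real assumes "0 < a" "a < b" "b < pi" shows "sin b / b < sin a / a"
proof (rule DERIV_neg_imp_decreasing [OF assms(2)])
  fix x assume "a \<le> x" "x \<le> b"
  with assms have x: "x > 0" "x < pi" by auto
  have "((\<lambda>x. sin x / x) has_real_derivative (cos x * x - sin x) / (x * x)) (at x)"
    using x by (auto intro!: derivative_eq_intros)
  with x mult_cos_less_sin [OF x]
  show "\<exists>y. ((\<lambda>x. sin x / x) has_real_derivative y) (at x) \<and> y < 0"
    by (intro exI [of _ "(cos x * x - sin x) / (x * x)"]) (auto simp: mult.commute divide_less_0_iff)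
qed

lemma ex1_x1:
  assumes "0 < \<rho>" "\<rho> < 1" shows "\<exists>!x::real. x > 0 \<and> \<rho> * (sinh x / x) = 1"
proof -
  let ?q = "\<lambda>x::real. sinh x / x"
  have *: "1 < 1 / \<rho>" using assms by simp
  have "(?q \<longlongrightarrow> 1) (at_right 0)" by real_asymp
  from order_tendstoD(2) [OF this *]
  have "eventually (\<lambda>x. ?q x < 1 / \<rho> \<and> x > 0) (at_right 0)"
    by (intro eventually_conj) (auto simp: eventually_at_right_less)
  then obtain a where a: "?q a < 1 / \<rho>" "a > 0"
    using eventually_happens' trivial_limit_at_right_real by blast
  have "filterlim ?q at_top at_top" by real_asymp
  then have "eventually (\<lambda>x. 1 / \<rho> \<le> ?q x \<and> x \<ge> a) at_top"
    by (intro eventually_conj eventually_ge_at_top) (auto simp: filterlim_at_top)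
  then obtain b where b: "1 / \<rho> \<le> ?q b" "b \<ge> a"
    using eventually_happens' trivial_limit_at_top_linorder by blast
  have "\<exists>x\<ge>a. x \<le> b \<and> ?q x = 1 / \<rho>"
    using a b by (intro IVT') (auto intro!: continuous_intros)
  then obtain x where "x \<ge> a" and q: "?q x = 1 / \<rho>" by blast
  with a have "x > 0" by linarith
  note x = this q
  show ?thesis
  proof (rule ex1I [of _ x])
    show "x > 0 \<and> \<rho> * ?q x = 1" using x assms by simp
  next
    fix y assume "y > 0 \<and> \<rho> * ?q y = 1"
    then have "y > 0" "?q y = 1 / \<rho>" using assms by (auto simp: field_simps)
    with x have "y > 0" "?q y = ?q x" by auto
    then show "y = x"
      using sinh_div_strict_mono [of x y] sinh_div_strict_mono [of y x] x by fastforce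
  qed
qed

lemma ex1_y1:
  assumes "\<rho> > 1" shows "\<exists>!y::real. y \<in> {0<..<pi} \<and> y + \<rho> * sin y = pi"
proof -
  let ?p = "\<lambda>z::real. sin z / z"
  have *: "1 / \<rho> < 1" using assms by simp
  have "(?p \<longlongrightarrow> 1) (at_right 0)" by real_asymp
  from order_tendstoD(1) [OF this *]
  have "eventually (\<lambda>z. 1 / \<rho> < ?p z \<and> z \<in> {0<..<pi}) (at_right 0)"
    by (intro eventually_conj eventually_at_right_real) auto
  then obtain a where a: "1 / \<rho> < ?p a" "a > 0" "a < pi"
    using eventually_happens' trivial_limit_at_right_real by (metis (lifting) greaterThanLessThan_iff)
  have "\<exists>z\<ge>a. z \<le> pi \<and> ?p z = 1 / \<rho>"
    using a assms by (intro IVT2') (auto intro!: continuous_intros)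
  then obtain z where z: "z \<ge> a" "z \<le> pi" "?p z = 1 / \<rho>" by auto
  from z assms have "z \<noteq> pi" by auto
  with z a have z': "0 < z" "z < pi" by auto
  show ?thesis
  proof (rule ex1I [of _ "pi - z"])
    show "pi - z \<in> {0<..<pi} \<and> pi - z + \<rho> * sin (pi - z) = pi"
      using z z' assms by (auto simp: field_simps)
  next
    fix y assume y: "y \<in> {0<..<pi} \<and> y + \<rho> * sin y = pi"
    define w where "w = pi - y"
    have w: "0 < w" "w < pi" using y by (auto simp: w_def)
    have "\<rho> * sin w = w" using y by (simp add: w_def)
    then have "?p w = 1 / \<rho>" using w assms by (simp add: field_simps)
    with z have "?p w = ?p z" by simp
    then have "w = z"
      using sin_div_strict_antimono [of w z] sin_div_strict_antimono [of z w] w z' by fastforce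
    then show "y = pi - z" by (simp add: w_def)
  qed
qed

lemma x1:
  assumes "0 < \<rho>" "\<rho> < 1" shows "x1 \<rho> > 0" "\<rho> * (sinh (x1 \<rho>) / x1 \<rho>) = 1"
  using theI' [OF ex1_x1 [OF assms]] by (auto simp: x1_def)

lemma y1:
  assumes "\<rho> > 1" shows "0 < y1 \<rho>" "y1 \<rho> < pi" "y1 \<rho> + \<rho> * sin (y1 \<rho>) = pi"
  using theI' [OF ex1_y1 [OF assms]] by (auto simp: y1_def)

lemma g0_pos:
  assumes "\<rho> > 0" shows "g0 \<rho> > 0"
proof -
  consider "\<rho> < 1" | "\<rho> = 1" | "\<rho> > 1" by linarith
  then show ?thesis
  proof cases
    case 1
    note x = x1 [OF assms 1]
    have "\<rho> * sinh (x1 \<rho>) = x1 \<rho>" using x by (simp add: field_simps)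
    moreover have "\<rho> * sinh (x1 \<rho>) < \<rho> * (x1 \<rho> * cosh (x1 \<rho>))"
      using sinh_less_mult_cosh [OF x(1)] assms by simp
    ultimately have "x1 \<rho> * 1 < x1 \<rho> * (\<rho> * cosh (x1 \<rho>))" by (simp add: mult_ac)
    then have "1 < \<rho> * cosh (x1 \<rho>)" using x(1) by (simp only: mult_less_cancel_left_pos)
    then show ?thesis using 1 x by (simp add: g0_def)
  next
    case 2
    then show ?thesis by (simp add: g0_def)
  next
    case 3
    note y = y1 [OF 3]
    define z where "z = pi - y1 \<rho>"
    have z: "0 < z" "z < pi" using y by (auto simp: z_def)
    have "\<rho> * sin z = z" using y by (simp add: z_def)
    moreover have "\<rho> * (z * cos z) < \<rho> * sin z"
      using mult_cos_less_sin [OF z] assms by simp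
    ultimately have "z * (\<rho> * cos z) < z * 1" by (simp add: mult_ac)
    then have "\<rho> * cos z < 1" using z(1) by (simp only: mult_less_cancel_left_pos)
    then have "\<rho> * cos (y1 \<rho>) + 1 > 0" by (simp add: z_def)
    moreover have "sin (y1 \<rho>) > 0" using y by (intro sin_gt_zero)
    ultimately show ?thesis using 3 by (simp add: g0_def)
  qed
qed

lemma delta_eq:
  assumes "\<tau> > 0" "\<rho> > 0"
  shows "Im (g (\<xi> \<tau>) \<rho>) = g0 \<rho> * (1 / sqrt \<tau>) * (1 + delta \<xi> \<tau> \<rho>)"
  using assms g0_pos [of \<rho>] by (simp add: delta_def)

lemma theta_eq:
  assumes "t > 0" "\<rho> > 0"
  shows "Im (LBINT \<tau>:{0<..}. of_real (exp (- \<tau> / t)) * g (\<xi> \<tau>) \<rho>)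
           = sqrt (pi * t) * g0 \<rho> * (1 + theta \<xi> t \<rho>)"
  using assms g0_pos [of \<rho>] by (simp add: theta_def)

end

theory Submission
  imports Defs "HOL-Complex_Analysis.Complex_Singularities"
begin

text \<open>Watson's lemma with an explicit remainder: integrating
  \<open>Im g = g\<^sub>0 \<tau>\<^sup>-\<^sup>1\<^sup>/\<^sup>2 (1 + \<delta>)\<close> against \<open>exp (- \<tau> / t)\<close>, the leading term gives
  \<open>\<Gamma>(1/2) t\<^sup>1\<^sup>/\<^sup>2\<close> and the remainder at most \<open>\<Gamma>(3/2) t\<^sup>3\<^sup>/\<^sup>2 / 35\<close>; the ratio is \<open>t / 70\<close>.

  The bound on \<open>\<delta>\<close> says nothing about the real part of \<open>g\<close>, so the integrability of the complex
  integrand has to be shown separately; without it the Bochner integral would be \<open>0\<close> by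
  convention. Here \<open>g = sinh / h'\<close>, and \<open>h\<close> moves at unit speed along the path. If \<open>h - h c\<close>
  vanishes to order \<open>n\<close> at a point \<open>c\<close> of the path, then \<open>1 / h'\<close> grows at most like
  \<open>\<bar>h - h c\<bar>\<close> to the power \<open>-(n - 1) / n\<close>, which is integrable in \<open>\<tau>\<close>. This treats the saddle
  point for all \<open>\<rho>\<close> at once and does not require that \<open>h'\<close> has no further zeros on the path. At
  infinity \<open>g\<close> tends to \<open>1 / \<rho>\<close>.\<close>

section \<open>Growth of the reciprocal derivative near a point\<close>

text \<open>Factor \<open>f z - f c = k z * (z - c) ^ n\<close> with \<open>k c\<close> nonzero.
  Then \<open>deriv f z\<close> is \<open>(z - c) ^ (n - 1)\<close> times a function that does not
  vanish at \<open>c\<close>, while \<open>norm (f z - f c)\<close> is at most a constant times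
  \<open>norm (z - c) ^ n\<close>. Eliminating \<open>norm (z - c)\<close> leaves the exponent
  \<open>(n - 1) / n\<close>, which is below 1 for every order \<open>n\<close>.\<close>

lemma inverse_deriv_bound_near:
  fixes f :: "complex \<Rightarrow> complex"
  assumes holo: "f holomorphic_on UNIV" and nonconst: "\<exists>w. f w \<noteq> f c"
  obtains C a where "0 \<le> a" "a < 1"
    "\<forall>\<^sub>F z in at c. norm (inverse (deriv f z)) \<le> C * norm (f z - f c) powr (-a)"
proof -
  define n where "n = nat (zorder (\<lambda>z. f z - f c) c)"
  define k where "k = zor_poly (\<lambda>z. f z - f c) c"
  have "(\<lambda>z. f z - f c) holomorphic_on UNIV"
    using holo by (intro holomorphic_intros)
  from zorder_exist_zero [OF this open_UNIV connected_UNIV, of c] nonconst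
  obtain r where n: "n > 0" and r: "r > 0" and k: "k holomorphic_on cball c r"
    and fk: "\<And>w. w \<in> cball c r \<Longrightarrow> f w - f c = k w * (w - c) ^ n" "\<And>w. w \<in> cball c r \<Longrightarrow> k w \<noteq> 0"
    by (auto simp: n_def k_def)
  have kb: "k holomorphic_on ball c r"
    using k by (rule holomorphic_on_subset) auto
  \<comment> \<open>The cofactor of \<open>(z - c) ^ (n - 1)\<close> in the derivative of
    \<open>k z * (z - c) ^ n\<close>; its value at \<open>c\<close> is \<open>n * k c\<close>, hence
    nonzero.\<close>
  define m where "m z = deriv k z * (z - c) + of_nat n * k z" for z
  have deriv_f: "deriv f z = (z - c) ^ (n - 1) * m z" if z: "z \<in> ball c r" for z
  proof -
    have "(k has_field_derivative deriv k z) (at z)"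
      using kb z by (intro holomorphic_derivI [OF kb]) auto
    then have "((\<lambda>w. f c + k w * (w - c) ^ n) has_field_derivative
        deriv k z * (z - c) ^ n + of_nat n * (z - c) ^ (n - 1) * k z) (at z)"
      by (auto intro!: derivative_eq_intros)
    moreover have "(z - c) ^ n = (z - c) ^ (n - 1) * (z - c)"
      using n by (metis power_minus_mult)
    ultimately have *: "((\<lambda>w. f c + k w * (w - c) ^ n) has_field_derivative
        (z - c) ^ (n - 1) * m z) (at z)"
      by (simp add: m_def algebra_simps)
    have "(f has_field_derivative (z - c) ^ (n - 1) * m z) (at z)"
      using fk(1) z
      by (intro has_field_derivative_transform_within_open [OF *, of "ball c r"])
         (auto simp: algebra_simps)
    then show ?thesis by (rule DERIV_imp_deriv)
  qed
  have m0: "m c \<noteq> 0" using n r fk(2) [of c] by (simp add: m_def)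
  have "m holomorphic_on ball c r"
    unfolding m_def using kb by (intro holomorphic_intros) auto
  then have contm: "isCont m c"
    using r continuous_on_eq_continuous_at holomorphic_on_imp_continuous_on
    by (metis centre_in_ball open_ball)
  have contk: "isCont k c"
    using r kb continuous_on_eq_continuous_at holomorphic_on_imp_continuous_on
    by (metis centre_in_ball open_ball)
  have ev1: "\<forall>\<^sub>F z in at c. norm (m z) > norm (m c) / 2"
    using contm m0 by (intro order_tendstoD(1) [of _ "norm (m c)"] tendsto_norm)
      (auto simp: isCont_def)
  have ev2: "\<forall>\<^sub>F z in at c. norm (k z) < norm (k c) + 1"
    using contk by (intro order_tendstoD(2) [of _ "norm (k c)"] tendsto_norm)
      (auto simp: isCont_def)
  have ev3: "\<forall>\<^sub>F z in at c. z \<in> ball c r" using r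
    by (intro eventually_at_in_open') auto
  have ev4: "\<forall>\<^sub>F z in at c. z \<noteq> c" by (rule eventually_neq_at_within)
  \<comment> \<open>Chosen so that \<open>(d ^ n) powr (-a)\<close> is exactly the inverse of
    \<open>d ^ (n - 1)\<close>.\<close>
  define a where "a = (real n - 1) / real n"
  define B where "B = norm (k c) + 1"
  have B: "B > 0" by (simp add: B_def add_nonneg_pos)
  have a: "0 \<le> a" "a < 1" using n by (auto simp: a_def)
  have "\<forall>\<^sub>F z in at c. norm (inverse (deriv f z)) \<le> 2 / norm (m c) * B powr a * norm (f z - f c) powr (-a)"
    using ev1 ev2 ev3 ev4
  proof eventually_elim
    case (elim z)
    define d where "d = norm (z - c)"
    have d: "d > 0" using elim by (simp add: d_def)
    \<comment> \<open>Strict positivity matters: \<open>0 powr (-a)\<close> is 0, so a negative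
      power is antitone only on positive arguments.\<close>
    have fpos: "norm (f z - f c) > 0" using fk [of z] elim by auto
    have "norm (f z - f c) \<le> B * d ^ n"
      using fk(1) [of z] elim by (simp add: norm_mult norm_power B_def d_def mult_right_mono)
    then have "(B * d ^ n) powr (-a) \<le> norm (f z - f c) powr (-a)"
      using a fpos by (intro powr_mono2') auto
    moreover have "(B * d ^ n) powr (-a) = B powr (-a) * inverse (d ^ (n - 1))"
    proof -
      have "(d ^ n) powr (-a) = d powr (- real (n - 1))"
        using n d by (simp add: powr_powr a_def of_nat_diff Suc_leI flip: powr_realpow)
      then show ?thesis using B d
        by (simp add: powr_mult powr_minus powr_realpow)
    qed
    ultimately have "B powr (-a) * inverse (d ^ (n - 1)) \<le> norm (f z - f c) powr (-a)"
      by simp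
    then have "B powr a * (B powr (-a) * inverse (d ^ (n - 1))) \<le> B powr a * norm (f z - f c) powr (-a)"
      by (intro mult_left_mono) auto
    then have "inverse (d ^ (n - 1)) \<le> B powr a * norm (f z - f c) powr (-a)"
      using B by (simp add: powr_minus flip: mult.assoc)
    moreover have "inverse (norm (m z)) \<le> 2 / norm (m c)"
      using le_imp_inverse_le [of "norm (m c) / 2" "norm (m z)"] elim m0 by simp
    ultimately have "inverse (norm (m z)) * inverse (d ^ (n - 1)) \<le>
        2 / norm (m c) * (B powr a * norm (f z - f c) powr (-a))"
      using d by (intro mult_mono) auto
    then show ?case
      using deriv_f [of z] elim by (simp add: norm_mult norm_inverse norm_power d_def mult_ac)
  qed
  with a that show ?thesis by blast
qed

section \<open>Integrable power singularities on the real line\<close>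

text \<open>The two-sided singularity is the sum of a translate and a reflected translate of the
  one-sided power on \<open>{0..e}\<close>.\<close>

lemma set_integrable_abs_powr:
  fixes c e a :: real
  assumes "a < 1" "e \<ge> 0"
  shows "set_integrable lborel {c - e..c + e} (\<lambda>x. \<bar>x - c\<bar> powr (-a))"
proof -
  define p where "p x = indicator {0..e} x * x powr (-a)" for x :: real
  have "(\<lambda>x. x powr (-a)) absolutely_integrable_on {0..e}"
    using assms by (intro nonnegative_absolutely_integrable_1 integrable_on_powr_from_0) auto
  then have p: "integrable lborel p"
    unfolding set_integrable_def p_def by (subst (asm) integrable_completion) auto
  have "integrable lborel (\<lambda>x. p (- c + 1 * x))" "integrable lborel (\<lambda>x. p (c + (-1) * x))"
    by (intro lborel_integrable_real_affine p; simp)+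
  then have "integrable lborel (\<lambda>x. p (x - c) + p (c - x))"
    by (intro Bochner_Integration.integrable_add) (simp_all add: algebra_simps)
  \<comment> \<open>The two copies overlap only at \<open>x = c\<close>, where both vanish because
    \<open>0 powr (-a)\<close> is 0; the identity therefore holds at every point.\<close>
  moreover have "p (x - c) + p (c - x) = indicator {c - e..c + e} x *\<^sub>R \<bar>x - c\<bar> powr (-a)" for x
    using assms by (auto simp: p_def indicator_def abs_if)
  ultimately show ?thesis by (simp add: set_integrable_def)
qed

text \<open>The point \<open>c\<close> is exempt from the bound, since the right-hand side is 0
  there by the convention for \<open>powr\<close>; a single point is a null set.\<close>

lemma set_integrable_powr_singularity:
  fixes F :: "real \<Rightarrow> complex"
  assumes "set_borel_measurable lborel A F" "A \<in> sets lborel" "A \<subseteq> {c - e..c + e}" "a < 1" "e \<ge> 0"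
    and bound: "\<And>x. x \<in> A \<Longrightarrow> x \<noteq> c \<Longrightarrow> norm (F x) \<le> C * \<bar>x - c\<bar> powr (-a)"
  shows "set_integrable lborel A F"
proof (rule set_integrable_bound)
  show "set_integrable lborel A (\<lambda>x. C * \<bar>x - c\<bar> powr (-a))"
    using assms by (intro set_integrable_mult_right set_integrable_subset [OF set_integrable_abs_powr])
  show "AE x in lborel. x \<in> A \<longrightarrow> norm (F x) \<le> norm (C * \<bar>x - c\<bar> powr (-a))"
    using AE_lborel_singleton [of c] by eventually_elim (use bound in force)
qed (use assms in auto)

section \<open>Laplace integrals and the remainder estimate\<close>

text \<open>Euler's integral for \<open>Gamma s\<close> after the substitution of
  \<open>x / t\<close> for the variable.\<close>

lemma has_bochner_integral_exp_powr:
  fixes s t :: real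
  assumes "s > 0" "t > 0"
  shows "has_bochner_integral lborel (\<lambda>x. indicator {0<..} x *\<^sub>R (exp (- x / t) * x powr (s - 1)))
           (Gamma s * t powr s)"
proof -
  define p where "p x = indicator {0..} x * (x powr (s - 1) / exp x)" for x :: real
  have "(\<integral>\<^sup>+x. ennreal (p x) \<partial>lborel) = ennreal (Gamma s)"
    using nn_integral_has_integral_lebesgue [OF _ Gamma_integral_real [OF assms(1)]]
    by (simp add: p_def)
  moreover have "p \<in> borel_measurable lborel" unfolding p_def by measurable
  ultimately have "has_bochner_integral lborel p (Gamma s)"
    using assms
    by (intro has_bochner_integral_nn_integral)
       (auto simp: p_def intro!: less_imp_le [OF Gamma_real_pos])
  then have "has_bochner_integral lborel (\<lambda>x. p (0 + (1 / t) * x)) (Gamma s /\<^sub>R \<bar>1 / t\<bar>)"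
    using assms by (subst (asm) lborel_has_bochner_integral_real_affine_iff [of "1/t" _ _ 0]) auto
  then have "has_bochner_integral lborel (\<lambda>x. t powr (s - 1) * p (x / t)) (t powr (s - 1) * (Gamma s * t))"
    using assms by (intro has_bochner_integral_mult_right) (auto simp: divide_simps mult_ac)
  \<comment> \<open>Including 0 in the support of \<open>p\<close> is harmless, because
    \<open>0 powr (s - 1)\<close> is 0.\<close>
  moreover have "t powr (s - 1) * p (x / t) = indicator {0<..} x *\<^sub>R (exp (- x / t) * x powr (s - 1))" for x
    using assms
    by (auto simp: p_def indicator_def powr_divide exp_minus field_simps zero_le_divide_iff)
  moreover have "t powr (s - 1) * (Gamma s * t) = Gamma s * t powr s"
    using assms by (simp add: powr_diff)
  ultimately show ?thesis by simp
qed

text \<open>The weights \<open>x powr (-1/2)\<close> and \<open>x powr (1/2)\<close> are the cases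
  \<open>s = 1/2\<close> and \<open>s = 3/2\<close> of the Gamma integral. Their ratio,
  \<open>t / 2\<close>, comes from \<open>Gamma (3/2) = Gamma (1/2) / 2\<close>. Integrability of
  the complex integrand allows \<open>Im\<close> to pass under the integral.\<close>

lemma Im_laplace_bound:
  fixes F :: "real \<Rightarrow> complex" and a k t :: real
  assumes t: "t > 0"
    and int: "set_integrable lborel {0<..} (\<lambda>x. of_real (exp (- x / t)) * F x)"
    and bound: "\<And>x. x > 0 \<Longrightarrow> \<bar>Im (F x) - a / sqrt x\<bar> \<le> k * sqrt x"
  shows "\<bar>Im (LBINT x:{0<..}. of_real (exp (- x / t)) * F x) - a * sqrt (pi * t)\<bar>
           \<le> k * (t * sqrt (pi * t) / 2)"
proof -
  let ?I = "LBINT x:{0<..}. of_real (exp (- x / t)) * F x"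
  let ?w = "\<lambda>s x. indicator {0<..} x *\<^sub>R (exp (- x / t) * x powr (s - 1)) :: real"
  let ?G = "\<lambda>x. indicator {0<..} x *\<^sub>R (of_real (exp (- x / t)) * F x)"
  have w1: "has_bochner_integral lborel (?w (1/2)) (sqrt (pi * t))"
    using has_bochner_integral_exp_powr [of "1/2" t] t
    by (simp add: Gamma_one_half_real powr_half_sqrt real_sqrt_mult)
  have "Gamma (3/2 :: real) = sqrt pi / 2"
    using Gamma_plus1 [of "1/2 :: real"] nonpos_Ints_nonpos [of "1/2 :: real"]
    by (auto simp: Gamma_one_half_real)
  moreover have "t powr (3/2) = t * sqrt t"
    using t powr_add [of t 1 "1/2"] by (simp add: powr_half_sqrt)
  ultimately have "Gamma (3/2) * t powr (3/2) = t * sqrt (pi * t) / 2"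
    by (simp add: real_sqrt_mult)
  then have w2: "has_bochner_integral lborel (?w (3/2)) (t * sqrt (pi * t) / 2)"
    using has_bochner_integral_exp_powr [of "3/2" t] t by (simp only:)
  have G: "integrable lborel ?G" using int by (simp add: set_integrable_def)
  have diff: "Im ?I - a * sqrt (pi * t) = (LBINT x. Im (?G x) - a * ?w (1/2) x)"
  proof (subst Bochner_Integration.integral_diff)
    show "integrable lborel (\<lambda>x. Im (?G x))" using G by (rule integrable_Im)
    show "integrable lborel (\<lambda>x. a * ?w (1/2) x)"
      using w1 by (intro integrable_mult_right) (simp add: has_bochner_integral_iff)
    have "Im ?I = (LBINT x. Im (?G x))"
      unfolding set_lebesgue_integral_def by (rule integral_Im [symmetric, OF G])
    moreover have "a * sqrt (pi * t) = (LBINT x. a * ?w (1/2) x)"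
      using has_bochner_integral_mult_right [of a, OF w1]
      by (simp only: has_bochner_integral_iff)
    ultimately show "Im ?I - a * sqrt (pi * t) = (LBINT x. Im (?G x)) - (LBINT x. a * ?w (1/2) x)"
      by simp
  qed
  have "\<bar>LBINT x. Im (?G x) - a * ?w (1/2) x\<bar> \<le> (LBINT x. k * ?w (3/2) x)"
  proof (rule integral_abs_bound_integral)
    show "integrable lborel (\<lambda>x. Im (?G x) - a * ?w (1/2) x)"
      using G w1 by (intro Bochner_Integration.integrable_diff integrable_Im integrable_mult_right)
        (simp_all add: has_bochner_integral_iff)
    show "integrable lborel (\<lambda>x. k * ?w (3/2) x)"
      using w2 by (intro integrable_mult_right) (simp add: has_bochner_integral_iff)
    fix x :: real
    show "\<bar>Im (?G x) - a * ?w (1/2) x\<bar> \<le> k * ?w (3/2) x"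
    proof (cases "x > 0")
      case True
      have w: "x powr (1/2 - 1) = 1 / sqrt x" "x powr (3/2 - 1) = sqrt x"
        using True powr_minus [of x "1/2"] by (simp_all add: powr_half_sqrt inverse_eq_divide)
      have lhs: "Im (?G x) - a * ?w (1/2) x = exp (- x / t) * (Im (F x) - a / sqrt x)"
        unfolding w using True by (simp add: right_diff_distrib)
      have rhs: "k * ?w (3/2) x = exp (- x / t) * (k * sqrt x)"
        unfolding w using True by simp
      have "exp (- x / t) * \<bar>Im (F x) - a / sqrt x\<bar> \<le> exp (- x / t) * (k * sqrt x)"
        using bound [OF True] by (intro mult_left_mono) auto
      then show ?thesis unfolding lhs rhs abs_mult abs_exp_cancel .
    qed auto
  qed
  also have "\<dots> = k * (t * sqrt (pi * t) / 2)"
    using has_bochner_integral_mult_right [of k, OF w2]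
    by (simp only: has_bochner_integral_iff)
  finally show ?thesis unfolding diff .
qed

section \<open>The functions \<open>h\<close> and \<open>g\<close>, and the behaviour of
  \<open>g\<close> at infinity\<close>

lemma deriv_h: "deriv (h \<rho>) z = z + of_real \<rho> * sinh z - \<i> * of_real pi"
  by (rule DERIV_imp_deriv [OF has_field_derivative_h])

lemma g_eq_deriv_h: "g z \<rho> = sinh z * inverse (deriv (h \<rho>) z)"
  by (simp add: g_def deriv_h divide_inverse)

lemma holomorphic_on_h: "h \<rho> holomorphic_on A"
  using has_field_derivative_h
  by (metis holomorphic_onI field_differentiable_at_within field_differentiable_def)

lemma norm_sinh_ge: "norm (sinh z) \<ge> sinh (Re z)" for z :: complex
proof -
  have "norm (exp z) - norm (exp (- z)) \<le> norm (exp z - exp (- z))"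
    by (rule norm_triangle_ineq2)
  moreover have "sinh z = (exp z - exp (- z)) /\<^sub>R 2" by (simp add: sinh_def)
  ultimately show ?thesis by (simp add: sinh_def norm_exp_eq_Re)
qed

text \<open>In the strip, \<open>z - \<i> * of_real pi\<close> has norm at most
  \<open>Re z + pi\<close>, which half of \<open>\<rho> * norm (sinh z)\<close> eventually absorbs.
  The other half remains as a lower bound for the denominator.\<close>

lemma norm_g_bound_at_infinity:
  assumes "\<rho> > 0"
  shows "\<forall>\<^sub>F x in at_top. \<forall>z. Re z = x \<longrightarrow> 0 < Im z \<longrightarrow> Im z < pi \<longrightarrow> norm (g z \<rho>) \<le> 2 / \<rho>"
proof -
  have "filterlim (\<lambda>x::real. \<rho> / 2 * sinh x - x - pi) at_top at_top"
    using assms by real_asymp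
  then have "\<forall>\<^sub>F x in at_top. \<rho> / 2 * sinh x - x - pi \<ge> 0"
    unfolding filterlim_at_top by blast
  then have "\<forall>\<^sub>F x in at_top. \<rho> / 2 * sinh x - x - pi \<ge> 0 \<and> x > 0"
    by (intro eventually_conj eventually_gt_at_top)
  then show ?thesis
  proof eventually_elim
    case (elim x)
    show ?case
    proof (intro allI impI)
      fix z assume z: "Re z = x" "0 < Im z" "Im z < pi"
      have "norm (z - \<i> * of_real pi) \<le> \<bar>Re (z - \<i> * of_real pi)\<bar> + \<bar>Im (z - \<i> * of_real pi)\<bar>"
        by (rule cmod_le)
      also have "\<dots> \<le> x + pi" using z elim by simp
      also have "\<dots> \<le> \<rho> / 2 * sinh x" using elim by simp
      also have "\<dots> \<le> \<rho> / 2 * norm (sinh z)" using norm_sinh_ge [of z] z assms by simp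
      finally have *: "norm (z - \<i> * of_real pi) \<le> \<rho> / 2 * norm (sinh z)" .
      have "\<rho> * norm (sinh z) - norm (z - \<i> * of_real pi)
          \<le> norm (of_real \<rho> * sinh z + (z - \<i> * of_real pi))"
        using norm_diff_ineq [of "of_real \<rho> * sinh z" "z - \<i> * of_real pi"] assms
        by (simp add: norm_mult)
      with * have D: "\<rho> / 2 * norm (sinh z) \<le> norm (z + of_real \<rho> * sinh z - \<i> * of_real pi)"
        by (simp add: algebra_simps)
      have "norm (sinh z) > 0" using norm_sinh_ge [of z] z elim
        by (smt (verit) sinh_real_pos_iff)
      then have "\<rho> / 2 * norm (sinh z) > 0" using assms by simp
      then have "norm (g z \<rho>) \<le> norm (sinh z) / (\<rho> / 2 * norm (sinh z))"
        unfolding g_def norm_divide using D by (intro divide_left_mono) (auto intro!: mult_pos_pos)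
      also have "\<dots> = 2 / \<rho>" using \<open>norm (sinh z) > 0\<close> by (simp add: field_simps)
      finally show "norm (g z \<rho>) \<le> 2 / \<rho>" .
    qed
  qed
qed

section \<open>Integrability along the steepest descent path\<close>

lemma set_borel_measurable_g_path:
  fixes \<xi> :: "real \<Rightarrow> complex"
  assumes "continuous_on {0..} \<xi>" "A \<in> sets lborel" "A \<subseteq> {0..}"
  shows "set_borel_measurable lborel A (\<lambda>\<tau>. g (\<xi> \<tau>) \<rho>)"
proof -
  have num: "set_borel_measurable borel {0..} (\<lambda>\<tau>. sinh (\<xi> \<tau>))"
    and den: "set_borel_measurable borel {0..} (\<lambda>\<tau>. \<xi> \<tau> + of_real \<rho> * sinh (\<xi> \<tau>) - \<i> * of_real pi)"
    unfolding set_borel_measurable_def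
    by (auto intro!: borel_measurable_continuous_on_indicator continuous_intros assms(1))
  \<comment> \<open>Off \<open>{0..}\<close> the quotient is \<open>0 / 0 = 0\<close>, so the
    indicator may be moved into numerator and denominator. Division is Borel measurable even where
    the denominator vanishes.\<close>
  have "(\<lambda>\<tau>. indicator {0..} \<tau> *\<^sub>R g (\<xi> \<tau>) \<rho>) =
     (\<lambda>\<tau>. (indicator {0..} \<tau> *\<^sub>R sinh (\<xi> \<tau>)) /
       (indicator {0..} \<tau> *\<^sub>R (\<xi> \<tau> + of_real \<rho> * sinh (\<xi> \<tau>) - \<i> * of_real pi)))"
    by (auto simp: g_def indicator_def)
  then have "set_borel_measurable lborel {0..} (\<lambda>\<tau>. g (\<xi> \<tau>) \<rho>)"
    using num den by (simp add: set_borel_measurable_def)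
  then show ?thesis by (rule set_borel_measurable_subset) (use assms in auto)
qed

text \<open>Along the path \<open>norm (h \<rho> (\<xi> \<tau>) - h \<rho> (\<xi> c))\<close> equals
  \<open>\<bar>\<tau> - c\<bar>\<close>, so the bound on the reciprocal derivative becomes an
  integrable power of the parameter. The factor \<open>sinh (\<xi> \<tau>)\<close> is locally
  bounded by continuity.\<close>

lemma set_integrable_g_path_near:
  assumes path: "steepest_descent_path \<rho> \<xi>" and c: "c \<ge> 0"
  shows "\<exists>e>0. set_integrable lborel ({0..} \<inter> {c - e<..<c + e}) (\<lambda>\<tau>. g (\<xi> \<tau>) \<rho>)"
proof -
  have cont: "continuous_on {0..} \<xi>"
    and h_path: "\<And>\<tau>. \<tau> \<ge> 0 \<Longrightarrow> h \<rho> (\<xi> \<tau>) - h \<rho> (saddle_point \<rho>) = of_real \<tau>"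
    using path by (auto simp: steepest_descent_path_def)
  have h_diff: "h \<rho> (\<xi> \<tau>) - h \<rho> (\<xi> c) = of_real (\<tau> - c)" if "\<tau> \<ge> 0" for \<tau>
    using h_path [OF that] h_path [OF c] by (simp add: algebra_simps)
  \<comment> \<open>The path itself shows that \<open>h \<rho>\<close> is not constant: these two
    values differ by 1.\<close>
  have "h \<rho> (\<xi> (c + 1)) \<noteq> h \<rho> (\<xi> c)" using h_diff [of "c + 1"] c by auto
  then obtain C a where a: "0 \<le> a" "a < 1" and
    "\<forall>\<^sub>F z in at (\<xi> c). norm (inverse (deriv (h \<rho>) z)) \<le> C * norm (h \<rho> z - h \<rho> (\<xi> c)) powr (-a)"
    using inverse_deriv_bound_near [OF holomorphic_on_h, of \<rho> "\<xi> c"] by metis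
  then obtain d where d: "d > 0" and inv_bound: "\<And>z. z \<noteq> \<xi> c \<Longrightarrow> dist z (\<xi> c) < d \<Longrightarrow>
      norm (inverse (deriv (h \<rho>) z)) \<le> C * norm (h \<rho> z - h \<rho> (\<xi> c)) powr (-a)"
    unfolding eventually_at by auto
  have "continuous_on {0..} (\<lambda>\<tau>. sinh (\<xi> \<tau>))" using cont by (intro continuous_intros)
  then obtain e1 where e1: "e1 > 0" "\<And>\<tau>. \<tau> \<ge> 0 \<Longrightarrow> dist \<tau> c < e1 \<Longrightarrow> dist (sinh (\<xi> \<tau>)) (sinh (\<xi> c)) < 1"
    using c unfolding continuous_on_iff by (metis atLeast_iff zero_less_one)
  obtain e2 where e2: "e2 > 0" "\<And>\<tau>. \<tau> \<ge> 0 \<Longrightarrow> dist \<tau> c < e2 \<Longrightarrow> dist (\<xi> \<tau>) (\<xi> c) < d"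
    using cont c d unfolding continuous_on_iff by (metis atLeast_iff)
  define e where "e = min e1 e2"
  define S where "S = norm (sinh (\<xi> c)) + 1"
  have "set_integrable lborel ({0..} \<inter> {c - e<..<c + e}) (\<lambda>\<tau>. g (\<xi> \<tau>) \<rho>)"
  proof (rule set_integrable_powr_singularity [where c = c and e = e and a = a and C = "S * C"])
    fix \<tau> assume \<tau>: "\<tau> \<in> {0..} \<inter> {c - e<..<c + e}" "\<tau> \<noteq> c"
    then have "dist \<tau> c < e" by (auto simp: dist_real_def)
    with \<tau> have 1: "dist (sinh (\<xi> \<tau>)) (sinh (\<xi> c)) < 1" and 2: "dist (\<xi> \<tau>) (\<xi> c) < d"
      using e1(2) e2(2) by (auto simp: e_def)
    have "norm (sinh (\<xi> \<tau>)) \<le> S"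
      using 1 norm_triangle_ineq2 [of "sinh (\<xi> \<tau>)" "sinh (\<xi> c)"] by (simp add: S_def dist_norm)
    moreover have "\<xi> \<tau> \<noteq> \<xi> c" using h_diff [of \<tau>] \<tau> by auto
    with 2 have "norm (inverse (deriv (h \<rho>) (\<xi> \<tau>))) \<le> C * \<bar>\<tau> - c\<bar> powr (-a)"
      using inv_bound [of "\<xi> \<tau>"] h_diff [of \<tau>] \<tau> by (simp flip: of_real_diff)
    ultimately have "norm (g (\<xi> \<tau>) \<rho>) \<le> S * (C * \<bar>\<tau> - c\<bar> powr (-a))"
      unfolding g_eq_deriv_h norm_mult by (intro mult_mono) (auto simp: S_def)
    then show "norm (g (\<xi> \<tau>) \<rho>) \<le> S * C * \<bar>\<tau> - c\<bar> powr (-a)" by (simp add: mult.assoc)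
  qed (use a e1 e2 cont in \<open>auto simp: e_def intro!: set_borel_measurable_g_path\<close>)
  moreover have "e > 0" using e1 e2 by (simp add: e_def)
  ultimately show ?thesis by blast
qed

text \<open>Finitely many of the local windows cover the compact parameter interval.\<close>

lemma set_integrable_g_path_compact:
  assumes path: "steepest_descent_path \<rho> \<xi>"
  shows "set_integrable lborel {0..T} (\<lambda>\<tau>. g (\<xi> \<tau>) \<rho>)"
proof -
  obtain e where e: "\<And>c. c \<ge> 0 \<Longrightarrow> e c > 0"
    "\<And>c. c \<ge> 0 \<Longrightarrow> set_integrable lborel ({0..} \<inter> {c - e c<..<c + e c}) (\<lambda>\<tau>. g (\<xi> \<tau>) \<rho>)"
    using set_integrable_g_path_near [OF path] by metis
  have "{0..T} \<subseteq> (\<Union>c\<in>{0..T}. {c - e c<..<c + e c})" using e(1) by force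
  then obtain K where K: "K \<subseteq> {0..T}" "finite K" "{0..T} \<subseteq> (\<Union>c\<in>K. {c - e c<..<c + e c})"
    using compactE_image [of "{0..T}" "{0..T}" "\<lambda>c. {c - e c<..<c + e c}"]
    by (metis compact_Icc open_greaterThanLessThan)
  have "set_integrable lborel (\<Union>c\<in>K. {0..} \<inter> {c - e c<..<c + e c}) (\<lambda>\<tau>. g (\<xi> \<tau>) \<rho>)"
    using K e(2) by (intro set_integrable_UN) auto
  then show ?thesis by (rule set_integrable_subset) (use K in auto)
qed

text \<open>Up to \<open>T\<close> the exponential is at most 1 and \<open>g\<close> is integrable;
  beyond \<open>T\<close> the function \<open>g\<close> is bounded and the exponential is
  integrable.\<close>

lemma set_integrable_laplace_g_path:
  assumes path: "steepest_descent_path \<rho> \<xi>" and "\<rho> > 0" and t: "t > 0"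
  shows "set_integrable lborel {0<..} (\<lambda>\<tau>. of_real (exp (- \<tau> / t)) * g (\<xi> \<tau>) \<rho>)"
proof -
  have cont: "continuous_on {0..} \<xi>" using path by (simp add: steepest_descent_path_def)
  have meas: "set_borel_measurable lborel A (\<lambda>\<tau>. of_real (exp (- \<tau> / t)) * g (\<xi> \<tau>) \<rho>)"
    if "A \<in> sets lborel" "A \<subseteq> {0..}" for A
  proof -
    have "(\<lambda>\<tau>. of_real (exp (- \<tau> / t)) * (indicator A \<tau> *\<^sub>R g (\<xi> \<tau>) \<rho>)) \<in> borel_measurable lborel"
      using set_borel_measurable_g_path [OF cont that, of \<rho>] unfolding set_borel_measurable_def
      by (intro borel_measurable_times) auto
    then show ?thesis by (simp add: set_borel_measurable_def scaleR_conv_of_real mult_ac)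
  qed
  have "filterlim (\<lambda>\<tau>. Re (\<xi> \<tau>)) at_top at_top" using path by (simp add: steepest_descent_path_def)
  from eventually_compose_filterlim [OF norm_g_bound_at_infinity [OF \<open>\<rho> > 0\<close>] this]
  obtain T where T: "\<And>\<tau>. \<tau> \<ge> T \<Longrightarrow> 0 < Im (\<xi> \<tau>) \<Longrightarrow> Im (\<xi> \<tau>) < pi \<Longrightarrow> norm (g (\<xi> \<tau>) \<rho>) \<le> 2 / \<rho>"
    unfolding eventually_at_top_linorder by blast
  have "set_integrable lborel {0<..T} (\<lambda>\<tau>. of_real (exp (- \<tau> / t)) * g (\<xi> \<tau>) \<rho>)"
  proof (rule set_integrable_bound)
    show "set_integrable lborel {0<..T} (\<lambda>\<tau>. g (\<xi> \<tau>) \<rho>)"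
      by (rule set_integrable_subset [OF set_integrable_g_path_compact [OF path, of T]]) auto
    show "AE \<tau> in lborel. \<tau> \<in> {0<..T} \<longrightarrow>
        norm (of_real (exp (- \<tau> / t)) * g (\<xi> \<tau>) \<rho>) \<le> norm (g (\<xi> \<tau>) \<rho>)"
      using t by (auto simp: norm_mult intro!: mult_left_le_one_le)
  qed (rule meas; auto)
  \<comment> \<open>\<open>T\<close> may be negative, whereas the path is known to lie in the open
    strip only for positive parameters.\<close>
  moreover have "set_integrable lborel {max 0 T<..} (\<lambda>\<tau>. of_real (exp (- \<tau> / t)) * g (\<xi> \<tau>) \<rho>)"
  proof (rule set_integrable_bound)
    \<comment> \<open>The factor \<open>\<tau> powr (1 - 1)\<close> is 1 for positive
      \<open>\<tau>\<close>; it is kept to match the Gamma integral with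
      \<open>s = 1\<close>.\<close>
    have "set_integrable lborel {0<..} (\<lambda>\<tau>. exp (- \<tau> / t) * \<tau> powr (1 - 1))"
      using has_bochner_integral_exp_powr [of 1 t] t
      by (auto simp: has_bochner_integral_iff set_integrable_def)
    then have "set_integrable lborel {max 0 T<..} (\<lambda>\<tau>. exp (- \<tau> / t) * \<tau> powr (1 - 1))"
      by (rule set_integrable_subset) auto
    then show "set_integrable lborel {max 0 T<..} (\<lambda>\<tau>. 2 / \<rho> * (exp (- \<tau> / t) * \<tau> powr (1 - 1)))"
      by (intro set_integrable_mult_right)
    show "AE \<tau> in lborel. \<tau> \<in> {max 0 T<..} \<longrightarrow>
        norm (of_real (exp (- \<tau> / t)) * g (\<xi> \<tau>) \<rho>) \<le> norm (2 / \<rho> * (exp (- \<tau> / t) * \<tau> powr (1 - 1)))"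
    proof (intro AE_I2 impI)
      fix \<tau> assume \<tau>: "\<tau> \<in> {max 0 T<..}"
      then have "0 < Im (\<xi> \<tau>)" "Im (\<xi> \<tau>) < pi"
        using path by (auto simp: steepest_descent_path_def)
      with T [of \<tau>] \<tau> have "norm (g (\<xi> \<tau>) \<rho>) \<le> 2 / \<rho>" by auto
      then have "exp (- \<tau> / t) * norm (g (\<xi> \<tau>) \<rho>) \<le> exp (- \<tau> / t) * (2 / \<rho>)"
        by (intro mult_left_mono) auto
      then show "norm (of_real (exp (- \<tau> / t)) * g (\<xi> \<tau>) \<rho>)
          \<le> norm (2 / \<rho> * (exp (- \<tau> / t) * \<tau> powr (1 - 1)))"
        using \<tau> \<open>\<rho> > 0\<close> by (simp add: norm_mult mult_ac)
    qed
  qed (rule meas; auto)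
  ultimately have "set_integrable lborel ({0<..T} \<union> {max 0 T<..})
      (\<lambda>\<tau>. of_real (exp (- \<tau> / t)) * g (\<xi> \<tau>) \<rho>)"
    by (intro set_integrable_Un) auto
  then show ?thesis by (rule set_integrable_subset) auto
qed

theorem proposition1:
  fixes \<xi> :: "real \<Rightarrow> real \<Rightarrow> complex"
  assumes path: "\<And>\<rho>. \<rho> > 0 \<Longrightarrow> steepest_descent_path \<rho> (\<xi> \<rho>)"
    and delta_bound: "\<And>\<tau> \<rho>. \<tau> > 0 \<Longrightarrow> \<rho> > 0 \<Longrightarrow> \<bar>delta (\<xi> \<rho>) \<tau> \<rho>\<bar> < 1 / 35 * \<tau>"
  shows "\<forall>t>0. \<forall>\<rho>>0. \<bar>theta (\<xi> \<rho>) t \<rho>\<bar> \<le> 1 / 70 * t"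
proof (intro allI impI)
  fix t \<rho> :: real assume t: "t > 0" and \<rho>: "\<rho> > 0"
  note g0 = g0_pos [OF \<rho>]
  define s where "s = sqrt (pi * t)"
  have s: "s > 0" using t by (simp add: s_def)
  \<comment> \<open>The remainder estimate with \<open>a = g0 \<rho>\<close> and
    \<open>k = g0 \<rho> / 35\<close>: multiplying the bound \<open>\<tau> / 35\<close> by
    \<open>g0 \<rho> / sqrt \<tau>\<close> gives \<open>k * sqrt \<tau>\<close>.\<close>
  have "\<bar>Im (LBINT \<tau>:{0<..}. of_real (exp (- \<tau> / t)) * g (\<xi> \<rho> \<tau>) \<rho>) - g0 \<rho> * s\<bar>
      \<le> g0 \<rho> / 35 * (t * s / 2)"
    unfolding s_def
  proof (rule Im_laplace_bound [OF t set_integrable_laplace_g_path [OF path [OF \<rho>] \<rho> t]])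
    fix \<tau> :: real assume \<tau>: "\<tau> > 0"
    have "Im (g (\<xi> \<rho> \<tau>) \<rho>) - g0 \<rho> / sqrt \<tau> = g0 \<rho> / sqrt \<tau> * delta (\<xi> \<rho>) \<tau> \<rho>"
      using delta_eq [OF \<tau> \<rho>, of "\<xi> \<rho>"] by (simp add: algebra_simps)
    then have "\<bar>Im (g (\<xi> \<rho> \<tau>) \<rho>) - g0 \<rho> / sqrt \<tau>\<bar> = g0 \<rho> / sqrt \<tau> * \<bar>delta (\<xi> \<rho>) \<tau> \<rho>\<bar>"
      using g0 \<tau> by (simp add: abs_mult)
    also have "\<dots> \<le> g0 \<rho> / sqrt \<tau> * (1 / 35 * \<tau>)"
      using delta_bound [OF \<tau> \<rho>] g0 \<tau> by (intro mult_left_mono) auto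
    also have "\<dots> = g0 \<rho> / 35 * sqrt \<tau>"
      using \<tau> by (simp add: field_simps)
    finally show "\<bar>Im (g (\<xi> \<rho> \<tau>) \<rho>) - g0 \<rho> / sqrt \<tau>\<bar> \<le> g0 \<rho> / 35 * sqrt \<tau>" .
  qed
  \<comment> \<open>By \<open>theta_eq\<close> the deviation from the leading term
    \<open>g0 \<rho> * s\<close> is \<open>s * g0 \<rho>\<close> times \<open>theta\<close>; this
    positive factor then cancels.\<close>
  then have "\<bar>s * g0 \<rho> * theta (\<xi> \<rho>) t \<rho>\<bar> \<le> s * g0 \<rho> * (1 / 70 * t)"
    unfolding theta_eq [OF t \<rho>, folded s_def] by (simp add: algebra_simps)
  then show "\<bar>theta (\<xi> \<rho>) t \<rho>\<bar> \<le> 1 / 70 * t"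
    using g0 s by (simp add: abs_mult)
qed

end
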